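(* Let $d \in \mathbb{N}$, $c \in (0,\infty)$, $\alpha \in (0,1]$, $F \in C^{1}(\mathbb{R}^{d},\mathbb{R})$, let $\|\cdot\| \colon \mathbb{R}^{d} \to [0,\infty)$ be a norm, let $C \subseteq \mathbb{R}^{d}$ be a bounded and convex set, and let $\gamma \colon \mathbb{N}_{0} \to (0,\infty)$ satisfy $\limsup_{n\to\infty} \gamma_{n} = 0$. Assume for all $x,y \in C$ that $$(F'(x) - F'(y))(x-y) \leq c\,\|x-y\|^{1+\alpha}.$$ Assume that $\sum_{n=0}^{\infty} \mathbf{1}_{(0,1)}(\alpha)\, \gamma_{n}^{\frac{1+\alpha}{1-\alpha}} < \infty$ (i.e., if $\alpha<1$ then $\sum_{n=0}^{\infty} \gamma_{n}^{\frac{1+\alpha}{1-\alpha}} < \infty$, and no condition is imposed if $\alpha=1$). Let $x \colon \mathbb{N}_{0} \to C$ be a sequence, and assume for all $n \in \mathbb{N}_{0}$ that $$x_{n+1} = x_{n} - \gamma_{n} \nabla F(x_{n}).$$ Then: (i) $(F(x_{n}))_{n\in\mathbb{N}_{0}}$ converges in $\mathbb{R}$; (ii) $\sum_{n=0}^{\infty} \gamma_{n} \|\nabla F(x_{n})\|^{2} < \infty$; and (iii) if $\sum_{n=0}^{\infty} \gamma_{n} = \infty$, then $\limsup_{n\to\infty} \|\nabla F(x_{n})\| = 0$.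
   Context: $\mathbb{N}=\{1,2,3,\dots\}$ and $\mathbb{N}_{0}=\{0,1,2,\dots\}$. $C^{1}(\mathbb{R}^{d},\mathbb{R})$ denotes the set of continuously differentiable functions from $\mathbb{R}^d$ to $\mathbb{R}$. $F'(x)$ denotes the (Fréchet) derivative of $F$ at $x$, a linear map $\mathbb{R}^{d}\to\mathbb{R}$, so $(F'(x)-F'(y))(x-y)$ is the linear functional $F'(x)-F'(y)$ applied to the vector $x-y$. $\nabla F$ denotes the usual gradient with respect to the standard Euclidean inner product (the vector of partial derivatives), so that $F'(x)v = \langle \nabla F(x), v\rangle$ for $v\in\mathbb{R}^d$. $\mathbf{1}_{(0,1)}$ is the indicator function of the interval $(0,1)$; for $\alpha=1$ the summands $\mathbf{1}_{(0,1)}(\alpha)\gamma_{n}^{\frac{1+\alpha}{1-\alpha}}$ are understood to be $0$. *)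

theory Defs
  imports "HOL-Analysis.Analysis"
begin

definition C1 :: "(real ^ 'n \<Rightarrow> real) \<Rightarrow> bool" where
  "C1 F \<longleftrightarrow>
     (\<exists>F' :: real ^ 'n \<Rightarrow> ((real ^ 'n) \<Rightarrow>\<^sub>L real).
        (\<forall>x. (F has_derivative blinfun_apply (F' x)) (at x)) \<and> continuous_on UNIV F')"

definition grad :: "(real ^ 'n \<Rightarrow> real) \<Rightarrow> real ^ 'n \<Rightarrow> real ^ 'n" where
  "grad F x = (\<chi> i. deriv (\<lambda>t. F (x + t *\<^sub>R axis i 1)) 0)"

text \<open>An arbitrary norm, in general different from the Euclidean \<^const>\<open>norm\<close> of the type.\<close>

definition is_norm :: "('a::real_vector \<Rightarrow> real) \<Rightarrow> bool" where
  "is_norm N \<longleftrightarrow>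
     (\<forall>x. 0 \<le> N x) \<and> (\<forall>x. N x = 0 \<longleftrightarrow> x = 0) \<and>
     (\<forall>a x. N (a *\<^sub>R x) = \<bar>a\<bar> * N x) \<and> (\<forall>x y. N (x + y) \<le> N x + N y)"

lemma frechet_derivative_eq_inner_grad:
  fixes F :: "real ^ 'n \<Rightarrow> real"
  assumes "F differentiable at x"
  shows "frechet_derivative F (at x) v = inner (grad F x) v"
proof -
  let ?D = "frechet_derivative F (at x)"
  have D: "(F has_derivative ?D) (at x)"
    using assms frechet_derivative_works by blast
  then have lin: "linear ?D" by (rule has_derivative_linear)
  have nth: "grad F x $ i = ?D (axis i 1)" for i
  proof -
    have g: "((\<lambda>t. x + t *\<^sub>R axis i 1) has_derivative (\<lambda>t. t *\<^sub>R axis i 1)) (at (0::real))"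
      by (auto intro!: derivative_eq_intros)
    have "((\<lambda>t. F (x + t *\<^sub>R axis i 1)) has_derivative (\<lambda>t. ?D (t *\<^sub>R axis i 1))) (at (0::real))"
      using has_derivative_compose[OF g, of F ?D] D by simp
    also have "(\<lambda>t. ?D (t *\<^sub>R axis i 1)) = (*) (?D (axis i 1))"
      using lin by (auto simp: linear_cmul mult.commute)
    finally have "((\<lambda>t. F (x + t *\<^sub>R axis i 1)) has_field_derivative ?D (axis i 1)) (at 0)"
      by (simp add: has_field_derivative_def)
    then show ?thesis by (simp add: grad_def DERIV_imp_deriv)
  qed
  have "?D v = ?D (\<Sum>i\<in>UNIV. v $ i *\<^sub>R axis i 1)"
    using basis_expansion[of v] by (simp add: scalar_mult_eq_scaleR)
  also have "\<dots> = (\<Sum>i\<in>UNIV. v $ i * ?D (axis i 1))"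
    using lin by (simp add: linear_sum linear_cmul)
  also have "\<dots> = inner (grad F x) v"
    by (simp add: inner_vec_def nth mult.commute)
  finally show ?thesis .
qed

end

theory Submission
  imports Defs
begin

text \<open>
  Write \<open>g n\<close> for the gradient at \<open>x n\<close>. By the mean value theorem, the one-sided Hoelder condition
  on the derivative gives
  \<open>F (x (n + 1)) \<le> F (x n) - \<gamma> n * |g n|^2 + L * (\<gamma> n * |g n|) powr (1 + \<alpha>)\<close>.
  The last term either is at most half of the decrease or is bounded by a multiple of
  \<open>\<gamma> n powr ((1 + \<alpha>) / (1 - \<alpha>))\<close>, which is summable; if \<open>\<alpha> = 1\<close>, the first alternative holds
  eventually because \<open>\<gamma>\<close> tends to 0. As \<open>F\<close> is bounded below on \<open>C\<close>, this yields the first two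
  claims. For the third one, the path from an iterate with \<open>|g n| \<ge> 2 * \<epsilon>\<close> to the next one with
  \<open>|g k| < \<epsilon>\<close> has length at most the sum of \<open>\<gamma> j * |g j|^2 / \<epsilon>\<close> over \<open>n \<le> j < k\<close>, which
  contradicts the uniform continuity of the gradient once \<open>n\<close> is large.
\<close>

text \<open>Expanding \<open>v\<close> in the standard basis bounds \<open>N v\<close> by the
  coordinates of \<open>v\<close>, each at most \<open>norm v\<close>. The bound is used in both
  directions of the argument: it makes the Hoelder condition Euclidean, and it carries the Euclidean
  conclusions over to \<open>N\<close>.\<close>

lemma is_norm_le_norm:
  fixes N :: "real ^ 'n \<Rightarrow> real"
  assumes "is_norm N"
  obtains k where "0 < k" "\<And>v. N v \<le> k * norm v"
proof
  let ?k = "(\<Sum>i\<in>UNIV. N (axis i 1)) + 1"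
  have nonneg: "0 \<le> N v" and scale: "N (a *\<^sub>R v) = \<bar>a\<bar> * N v" and tri: "N (v + w) \<le> N v + N w"
    and zero: "N 0 = 0" for v w a
    using assms by (auto simp: is_norm_def)
  show "0 < ?k"
    by (intro add_nonneg_pos sum_nonneg nonneg) simp
  have sum_le: "N (sum f A) \<le> (\<Sum>i\<in>A. N (f i))" if "finite A" for f :: "'n \<Rightarrow> real ^ 'n" and A
    using that
  proof induction
    case (insert i A)
    then show ?case using tri[of "f i" "sum f A"] by simp
  qed (simp add: zero)
  show "N v \<le> ?k * norm v" for v
  proof -
    have "N v = N (\<Sum>i\<in>UNIV. v $ i *\<^sub>R axis i 1)"
      using basis_expansion[of v] by (simp add: scalar_mult_eq_scaleR)
    also have "\<dots> \<le> (\<Sum>i\<in>UNIV. N (v $ i *\<^sub>R axis i 1))"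
      by (rule sum_le) simp
    also have "\<dots> \<le> (\<Sum>i\<in>UNIV. norm v * N (axis i 1))"
      unfolding scale by (intro sum_mono mult_right_mono component_le_norm_cart nonneg)
    also have "\<dots> = norm v * (\<Sum>i\<in>UNIV. N (axis i 1))"
      by (simp add: sum_distrib_left)
    also have "\<dots> \<le> ?k * norm v"
      by (simp add: algebra_simps)
    finally show ?thesis .
  qed
qed

lemma C1_has_derivative_grad:
  assumes "C1 F"
  shows "(F has_derivative (\<lambda>v. grad F x \<bullet> v)) (at x)"
proof -
  have "F differentiable at x"
    using assms unfolding C1_def differentiable_def by blast
  moreover from this have "frechet_derivative F (at x) = (\<lambda>v. grad F x \<bullet> v)"
    by (auto simp: frechet_derivative_eq_inner_grad)
  ultimately show ?thesis
    by (simp add: frechet_derivative_works)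
qed

text \<open>By uniqueness of the derivative, the coordinates of the gradient are the values on the
  basis vectors of the continuous derivative that \<open>C1\<close> provides.\<close>

lemma C1_continuous_on_grad:
  assumes "C1 F"
  shows "continuous_on S (grad F)"
proof -
  obtain F' where F': "\<And>x. (F has_derivative blinfun_apply (F' x)) (at x)" "continuous_on UNIV F'"
    using assms unfolding C1_def by blast
  have "grad F x $ i = blinfun_apply (F' x) (axis i 1)" for x i
    using has_derivative_unique[OF F'(1) C1_has_derivative_grad[OF assms], of x]
    by (simp add: inner_axis)
  then have "grad F = (\<lambda>x. \<chi> i. blinfun_apply (F' x) (axis i 1))"
    by (auto simp: vec_eq_iff)
  moreover have "continuous_on S (\<lambda>x. \<chi> i. blinfun_apply (F' x) (axis i 1))"
    by (intro continuous_on_vec_lambda continuous_intros continuous_on_subset[OF F'(2)]) simp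
  ultimately show ?thesis by simp
qed

lemma one_sided_Hoelder_descent:
  fixes F :: "'a::real_inner \<Rightarrow> real"
  assumes deriv: "\<And>z. (F has_derivative (\<lambda>v. G z \<bullet> v)) (at z)"
    and C: "convex C" "x \<in> C" "y \<in> C"
    and pos: "0 \<le> L" "0 < \<alpha>"
    and Hoelder: "\<And>x y. x \<in> C \<Longrightarrow> y \<in> C \<Longrightarrow>
      (G x - G y) \<bullet> (x - y) \<le> L * norm (x - y) powr (1 + \<alpha>)"
  shows "F y \<le> F x + G x \<bullet> (y - x) + L * norm (y - x) powr (1 + \<alpha>)"
proof -
  define v where "v = y - x"
  have "((\<lambda>s. F (x + s *\<^sub>R v)) has_derivative (\<lambda>h. G (x + t *\<^sub>R v) \<bullet> (h *\<^sub>R v))) (at t)" for t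
    by (rule has_derivative_compose[OF _ deriv]) (auto intro!: derivative_eq_intros)
  then have D: "((\<lambda>s. F (x + s *\<^sub>R v)) has_real_derivative G (x + t *\<^sub>R v) \<bullet> v) (at t)" for t
    by (simp add: has_field_derivative_def mult.commute[of _ "G _ \<bullet> v"])
  obtain t where t: "0 < t" "t < 1" and eq: "F (x + 1 *\<^sub>R v) - F (x + 0 *\<^sub>R v) = (1 - 0) * (G (x + t *\<^sub>R v) \<bullet> v)"
    using MVT2[of 0 1 "\<lambda>s. F (x + s *\<^sub>R v)" "\<lambda>t. G (x + t *\<^sub>R v) \<bullet> v"] D by auto
  have "x + t *\<^sub>R v = (1 - t) *\<^sub>R x + t *\<^sub>R y"
    by (simp add: v_def algebra_simps)
  then have "x + t *\<^sub>R v \<in> C"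
    using C t by (simp add: convexD)
  \<comment> \<open>The intermediate point differs from \<open>x\<close> by
    \<open>t *\<^sub>R v\<close>, so the left side gains a factor \<open>t\<close> and the right
    side \<open>t powr (1 + \<alpha>)\<close>. Dividing by \<open>t\<close> leaves
    \<open>t powr \<alpha>\<close>, which is at most 1.\<close>
  from Hoelder[OF this C(2)]
  have "t * ((G (x + t *\<^sub>R v) - G x) \<bullet> v) \<le> L * (t powr (1 + \<alpha>) * norm v powr (1 + \<alpha>))"
    using t by (simp add: powr_mult)
  also have "\<dots> = t * (t powr \<alpha> * (L * norm v powr (1 + \<alpha>)))"
    using t by (simp add: powr_add)
  finally have "(G (x + t *\<^sub>R v) - G x) \<bullet> v \<le> t powr \<alpha> * (L * norm v powr (1 + \<alpha>))"
    using t by simp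
  also have "\<dots> \<le> L * norm v powr (1 + \<alpha>)"
    using t pos by (intro mult_left_le_one_le) (auto intro: powr_le1)
  finally show ?thesis
    using eq by (simp add: v_def inner_diff_left)
qed

text \<open>If the left side exceeds half of \<open>s * g\<^sup>2\<close>, then cancelling
  \<open>s * g powr (1 + \<alpha>)\<close> bounds \<open>g powr (1 - \<alpha>)\<close> by a multiple
  of \<open>s powr \<alpha>\<close>. So \<open>g\<close> is controlled by \<open>s\<close>, and the
  left side by a power of \<open>s\<close> alone.\<close>

lemma powr_absorb_into_square:
  fixes g s L \<alpha> :: real
  assumes "0 \<le> g" "0 < s" "0 < L" "0 < \<alpha>" "\<alpha> < 1"
  shows "L * (s * g) powr (1 + \<alpha>)
    \<le> s * g\<^sup>2 / 2 + L * (2 * L) powr ((1 + \<alpha>) / (1 - \<alpha>)) * s powr ((1 + \<alpha>) / (1 - \<alpha>))"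
proof (cases "L * (s * g) powr (1 + \<alpha>) \<le> s * g\<^sup>2 / 2")
  case True
  moreover have "0 \<le> L * (2 * L) powr ((1 + \<alpha>) / (1 - \<alpha>)) * s powr ((1 + \<alpha>) / (1 - \<alpha>))"
    using assms by simp
  ultimately show ?thesis by linarith
next
  case False
  let ?p = "(1 + \<alpha>) / (1 - \<alpha>)"
  have g: "0 < g"
    using False assms by (cases "g = 0") auto
  have "g\<^sup>2 = g powr (1 - \<alpha>) * g powr (1 + \<alpha>)"
    using g by (simp flip: powr_add add: powr_numeral)
  then have "s * g powr (1 + \<alpha>) * g powr (1 - \<alpha>) < s * g powr (1 + \<alpha>) * (2 * L * s powr \<alpha>)"
    using False assms g by (simp add: powr_mult powr_add[of s] mult_ac)
  then have "g powr (1 - \<alpha>) < 2 * L * s powr \<alpha>"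
    using assms g by (simp add: mult_less_cancel_left_pos)
  then have "(g powr (1 - \<alpha>)) powr ?p \<le> (2 * L * s powr \<alpha>) powr ?p"
    using assms by (intro powr_mono2) auto
  \<comment> \<open>The exponent \<open>?p\<close> satisfies
    \<open>(1 - \<alpha>) * ?p = 1 + \<alpha>\<close>; the same identity collapses the total
    exponent of \<open>s\<close> to \<open>?p\<close> below.\<close>
  then have "g powr (1 + \<alpha>) \<le> (2 * L) powr ?p * s powr (\<alpha> * ?p)"
    using assms g by (simp add: powr_powr powr_mult)
  then have "L * (s * g) powr (1 + \<alpha>) \<le> L * (s powr (1 + \<alpha>) * ((2 * L) powr ?p * s powr (\<alpha> * ?p)))"
    using assms by (simp add: powr_mult)
  also have "\<dots> = L * (2 * L) powr ?p * s powr ((1 + \<alpha>) + \<alpha> * ?p)"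
    by (simp add: powr_add)
  also have "(1 + \<alpha>) + \<alpha> * ?p = ?p"
    using assms by (simp add: field_simps)
  finally show ?thesis
    using assms by (smt (verit) mult_nonneg_nonneg zero_le_power2 divide_nonneg_nonneg)
qed

text \<open>Subtracting the partial sums of \<open>b\<close> from \<open>f\<close> gives a
  decreasing sequence that is bounded below; adding them back preserves convergence. Telescoping
  \<open>step\<close> bounds the partial sums of \<open>a\<close>.\<close>

lemma quasi_decreasing_convergent_summable:
  fixes f a b :: "nat \<Rightarrow> real"
  assumes step: "\<And>n. f (Suc n) \<le> f n - a n + b n"
    and nonneg: "\<And>n. 0 \<le> a n" "\<And>n. 0 \<le> b n"
    and b: "summable b"
    and lower: "\<And>n. B \<le> f n"
  shows "convergent f" and "summable a"
proof -
  have sum_b: "sum b {..<n} \<le> suminf b" for n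
    by (rule sum_le_suminf[OF b]) (auto simp: nonneg)
  let ?u = "\<lambda>n. f n - sum b {..<n}"
  have dec: "decseq ?u"
  proof (rule decseq_SucI)
    show "?u (Suc n) \<le> ?u n" for n
      using step[of n] nonneg(1)[of n] by simp
  qed
  have "B - suminf b \<le> ?u n" for n
    using lower[of n] sum_b[of n] by linarith
  then have "convergent ?u"
    using decseq_convergent[OF dec] by (metis convergentI)
  then have "convergent (\<lambda>n. ?u n + sum b {..<n})"
    by (intro convergent_add) (use b in \<open>simp_all add: summable_iff_convergent\<close>)
  then show "convergent f" by simp
  have sum_a: "sum a {..<n} \<le> f 0 - f n + sum b {..<n}" for n
  proof (induction n)
    case (Suc n)
    then show ?case using step[of n] by simp
  qed simp
  have "sum a {..<n} \<le> f 0 - B + suminf b" for n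
    using sum_a[of n] lower[of n] sum_b[of n] by linarith
  then show "summable a"
    by (rule summableI_nonneg_bounded[OF nonneg(1)])
qed

lemma gradient_step_tendsto_zero:
  fixes x :: "nat \<Rightarrow> 'a::real_normed_vector"
  assumes step: "\<And>n. x (Suc n) = x n - \<gamma> n *\<^sub>R G (x n)"
    and G: "uniformly_continuous_on C G" "\<And>n. x n \<in> C"
    and pos: "\<And>n. 0 < \<gamma> n"
    and summable: "summable (\<lambda>n. \<gamma> n * (norm (G (x n)))\<^sup>2)"
    and not_summable: "\<not> summable \<gamma>"
  shows "(\<lambda>n. G (x n)) \<longlonglongrightarrow> 0"
proof (rule LIMSEQ_I)
  fix r :: real
  assume "0 < r"
  define \<epsilon> where "\<epsilon> = r / 2"
  have \<epsilon>: "0 < \<epsilon>" using \<open>0 < r\<close> by (simp add: \<epsilon>_def)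
  let ?a = "\<lambda>n. \<gamma> n * (norm (G (x n)))\<^sup>2"
  obtain \<delta> where \<delta>: "0 < \<delta>"
    "\<And>y z. y \<in> C \<Longrightarrow> z \<in> C \<Longrightarrow> dist z y < \<delta> \<Longrightarrow> dist (G z) (G y) < \<epsilon>"
    using G(1) \<epsilon> unfolding uniformly_continuous_on_def by blast
  \<comment> \<open>A tail below \<open>\<epsilon> * \<delta>\<close> makes the path, whose length
    is at most the tail divided by \<open>\<epsilon>\<close>, shorter than
    \<open>\<delta>\<close>.\<close>
  obtain M where M: "\<And>m n. M \<le> m \<Longrightarrow> norm (sum ?a {m..<n}) < \<epsilon> * \<delta>"
    using summable \<epsilon> \<delta>(1) unfolding summable_Cauchy by (meson mult_pos_pos)
  have "norm (G (x n)) < r" if n: "M \<le> n" for n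
  proof (rule ccontr)
    assume "\<not> norm (G (x n)) < r"
    then have large: "2 * \<epsilon> \<le> norm (G (x n))" by (simp add: \<epsilon>_def)
    \<comment> \<open>If the gradients stayed at least \<open>\<epsilon>\<close> from
      \<open>n\<close> on, \<open>\<gamma>\<close> would be dominated by the summable
      \<open>?a\<close> divided by \<open>\<epsilon>\<^sup>2\<close>.\<close>
    have "\<exists>k\<ge>n. norm (G (x k)) < \<epsilon>"
    proof (rule ccontr)
      assume *: "\<not> ?thesis"
      have "norm (\<gamma> k) \<le> ?a k / \<epsilon>\<^sup>2" if "n \<le> k" for k
      proof -
        have "\<epsilon>\<^sup>2 \<le> (norm (G (x k)))\<^sup>2"
          using * that \<epsilon> by (intro power_mono) auto
        then have "\<gamma> k * \<epsilon>\<^sup>2 \<le> ?a k"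
          using pos[of k] by (intro mult_left_mono) auto
        then show ?thesis using \<epsilon> pos[of k] by (simp add: field_simps)
      qed
      then have "summable \<gamma>"
        by (rule summable_comparison_test'[OF summable_divide[OF summable]])
      then show False using not_summable by blast
    qed
    \<comment> \<open>Taking the first such index keeps the gradient at least
      \<open>\<epsilon>\<close> at every earlier point of the path, so each step length
      \<open>\<gamma> j * norm (G (x j))\<close> is at most
      \<open>?a j / \<epsilon>\<close>.\<close>
    define k where "k = (LEAST k. n \<le> k \<and> norm (G (x k)) < \<epsilon>)"
    have k: "n \<le> k" "norm (G (x k)) < \<epsilon>"
      using LeastI_ex[OF \<open>\<exists>k\<ge>n. norm (G (x k)) < \<epsilon>\<close>] by (auto simp: k_def)
    have before: "\<epsilon> \<le> norm (G (x j))" if "n \<le> j" "j < k" for j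
      using not_less_Least[of j "\<lambda>k. n \<le> k \<and> norm (G (x k)) < \<epsilon>"] that by (auto simp: k_def)
    have "norm (x k - x n) = norm (\<Sum>j=n..<k. x (Suc j) - x j)"
      using k(1) by (simp add: sum_Suc_diff')
    also have "\<dots> \<le> (\<Sum>j=n..<k. norm (x (Suc j) - x j))"
      by (rule norm_sum)
    also have "\<dots> \<le> (\<Sum>j=n..<k. ?a j / \<epsilon>)"
    proof (rule sum_mono)
      fix j assume "j \<in> {n..<k}"
      then have "\<gamma> j * norm (G (x j)) * \<epsilon> \<le> \<gamma> j * norm (G (x j)) * norm (G (x j))"
        using before[of j] pos[of j] by (intro mult_left_mono) auto
      then show "norm (x (Suc j) - x j) \<le> ?a j / \<epsilon>"
        using \<epsilon> pos[of j] by (simp add: step field_simps power2_eq_square)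
    qed
    also have "\<dots> = sum ?a {n..<k} / \<epsilon>"
      by (simp add: sum_divide_distrib)
    also have "\<dots> < \<delta>"
      using M[OF n, of k] \<epsilon> by (simp add: field_simps)
    finally have "dist (G (x k)) (G (x n)) < \<epsilon>"
      using \<delta>(2) G(2) by (simp add: dist_norm)
    then have "norm (G (x n)) < norm (G (x k)) + \<epsilon>"
      using norm_triangle_ineq2[of "G (x n)" "G (x k)"] by (simp add: dist_norm norm_minus_commute)
    then show False using k(2) large by linarith
  qed
  then show "\<exists>no. \<forall>n\<ge>no. norm (G (x n) - 0) < r" by auto
qed

theorem theorem4:
  fixes c \<alpha> :: real
    and F :: "real ^ 'n \<Rightarrow> real"
    and N :: "real ^ 'n \<Rightarrow> real"
    and C :: "(real ^ 'n) set"
    and \<gamma> :: "nat \<Rightarrow> real"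
    and x :: "nat \<Rightarrow> real ^ 'n"
  assumes "0 < c"
    and "\<alpha> \<in> {0<..1}"
    and "C1 F"
    and "is_norm N"
    and "bounded C" and "convex C"
    and "\<And>n. 0 < \<gamma> n"
    and "limsup (\<lambda>n. ereal (\<gamma> n)) = 0"
    and "\<And>x y. x \<in> C \<Longrightarrow> y \<in> C \<Longrightarrow>
           frechet_derivative F (at x) (x - y) - frechet_derivative F (at y) (x - y)
             \<le> c * N (x - y) powr (1 + \<alpha>)"
    and "summable (\<lambda>n. indicator {0<..<1} \<alpha> * \<gamma> n powr ((1 + \<alpha>) / (1 - \<alpha>)))"
    and "\<And>n. x n \<in> C"
    and "\<And>n. x (Suc n) = x n - \<gamma> n *\<^sub>R grad F (x n)"
  shows "convergent (\<lambda>n. F (x n)) \<and>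
         summable (\<lambda>n. \<gamma> n * (N (grad F (x n)))\<^sup>2) \<and>
         (\<not> summable \<gamma> \<longrightarrow> limsup (\<lambda>n. ereal (N (grad F (x n)))) = 0)"
proof -
  let ?G = "grad F"
  let ?g = "\<lambda>n. norm (?G (x n))"
  let ?p = "(1 + \<alpha>) / (1 - \<alpha>)"
  have \<alpha>: "0 < \<alpha>" "\<alpha> \<le> 1" using assms(2) by auto
  note pos = assms(7) and x_in = assms(11) and step = assms(12)
  have N_nonneg: "0 \<le> N v" for v using assms(4) by (simp add: is_norm_def)
  obtain k where k: "0 < k" "\<And>v. N v \<le> k * norm v"
    using is_norm_le_norm[OF assms(4)] by blast
  define L where "L = c * k powr (1 + \<alpha>)"
  have L: "0 < L" using \<open>0 < c\<close> k by (simp add: L_def)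
  have deriv: "(F has_derivative (\<lambda>v. ?G z \<bullet> v)) (at z)" for z
    by (rule C1_has_derivative_grad[OF assms(3)])
  then have diff: "F differentiable at z" for z
    unfolding differentiable_def by blast
  have Hoelder: "(?G y - ?G z) \<bullet> (y - z) \<le> L * norm (y - z) powr (1 + \<alpha>)"
    if "y \<in> C" "z \<in> C" for y z
  proof -
    have "N (y - z) powr (1 + \<alpha>) \<le> (k * norm (y - z)) powr (1 + \<alpha>)"
      using \<alpha> k N_nonneg by (intro powr_mono2) auto
    also have "\<dots> = k powr (1 + \<alpha>) * norm (y - z) powr (1 + \<alpha>)"
      using k by (simp add: powr_mult)
    finally have "c * N (y - z) powr (1 + \<alpha>) \<le> L * norm (y - z) powr (1 + \<alpha>)"
      using \<open>0 < c\<close> by (simp add: L_def)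
    then show ?thesis
      using assms(9)[OF that] by (simp add: frechet_derivative_eq_inner_grad[OF diff] inner_diff_left)
  qed
  have descent: "F (x (Suc n)) \<le> F (x n) - \<gamma> n * (?g n)\<^sup>2 + L * (\<gamma> n * ?g n) powr (1 + \<alpha>)" for n
  proof -
    have "F (x (Suc n)) \<le> F (x n) + ?G (x n) \<bullet> (x (Suc n) - x n)
        + L * norm (x (Suc n) - x n) powr (1 + \<alpha>)"
      using L by (intro one_sided_Hoelder_descent[OF deriv assms(6) x_in x_in _ \<alpha>(1) Hoelder]) auto
    then show ?thesis
      using pos[of n] by (simp add: step power2_norm_eq_inner)
  qed
  \<comment> \<open>Passing to the closure provides compactness, from which come both the lower
    bound of \<open>F\<close> and the uniform continuity of the gradient.\<close>
  have compact: "compact (closure C)"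
    using assms(5) by (simp add: compact_closure)
  have x_closure: "x n \<in> closure C" for n
    using x_in closure_subset by blast
  have "\<gamma> \<longlonglongrightarrow> 0"
  proof -
    have "0 \<le> liminf (\<lambda>n. ereal (\<gamma> n))"
      by (intro Liminf_bounded always_eventually) (simp add: less_imp_le[OF pos])
    then have "liminf (\<lambda>n. ereal (\<gamma> n)) = 0"
      using Liminf_le_Limsup[of sequentially "\<lambda>n. ereal (\<gamma> n)"] assms(8) by (simp add: order_antisym)
    then have "(\<lambda>n. ereal (\<gamma> n)) \<longlonglongrightarrow> 0"
      using assms(8) by (intro Liminf_eq_Limsup) auto
    then show ?thesis by (simp add: zero_ereal_def)
  qed
  \<comment> \<open>This is the excess of the Hoelder term over half of the decrease. Truncation at
    0 makes it nonnegative and lets the cases \<open>\<alpha> < 1\<close> and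
    \<open>\<alpha> = 1\<close> share the rest of the proof.\<close>
  define b where "b n = max 0 (L * (\<gamma> n * ?g n) powr (1 + \<alpha>) - \<gamma> n * (?g n)\<^sup>2 / 2)" for n
  have "summable b"
  proof (cases "\<alpha> < 1")
    case True
    then have "summable (\<lambda>n. \<gamma> n powr ?p)"
      using assms(10) \<alpha> by simp
    then have "summable (\<lambda>n. L * (2 * L) powr ?p * \<gamma> n powr ?p)"
      by (rule summable_mult)
    moreover have "norm (b n) \<le> L * (2 * L) powr ?p * \<gamma> n powr ?p" for n
      using powr_absorb_into_square[OF norm_ge_zero pos[of n] L \<alpha>(1) True, of "?G (x n)"] L
      by (auto simp: b_def)
    ultimately show ?thesis
      by (rule summable_comparison_test'[where N = 0])
  next
    case False
    then have \<alpha>: "\<alpha> = 1" using \<alpha> by simp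
    \<comment> \<open>For \<open>\<alpha> = 1\<close> the Hoelder term is
      \<open>L * \<gamma> n\<close> times the decrease \<open>\<gamma> n * (?g n)\<^sup>2\<close>,
      hence at most half of it once \<open>\<gamma> n\<close> is below this threshold; then
      \<open>b n\<close> vanishes.\<close>
    have "eventually (\<lambda>n. \<gamma> n < 1 / (2 * L)) sequentially"
      using order_tendstoD(2)[OF \<open>\<gamma> \<longlonglongrightarrow> 0\<close>, of "1 / (2 * L)"] L by simp
    then have "eventually (\<lambda>n. b n = 0) sequentially"
    proof eventually_elim
      case (elim n)
      then have "L * \<gamma> n * (\<gamma> n * (?g n)\<^sup>2) \<le> 1 / 2 * (\<gamma> n * (?g n)\<^sup>2)"
        using L pos[of n] by (intro mult_right_mono) (auto simp: field_simps)
      moreover have "(\<gamma> n * ?g n) powr (1 + \<alpha>) = (\<gamma> n * ?g n)\<^sup>2"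
        using pos[of n] by (simp add: \<alpha> powr_numeral)
      ultimately show ?case
        by (simp add: b_def power2_eq_square mult_ac)
    qed
    then show ?thesis
      by (simp add: summable_cong)
  qed
  obtain B where B: "\<And>z. z \<in> closure C \<Longrightarrow> B \<le> F z"
  proof -
    have "continuous_on (closure C) F"
      using deriv by (auto intro!: continuous_at_imp_continuous_on dest: has_derivative_continuous)
    then have "bounded (F ` closure C)"
      using compact by (intro compact_imp_bounded compact_continuous_image)
    then have "bdd_below (F ` closure C)"
      by (rule bounded_imp_bdd_below)
    then show ?thesis
      using that by (auto simp: bdd_below_def)
  qed
  have half: "F (x (Suc n)) \<le> F (x n) - \<gamma> n * (?g n)\<^sup>2 / 2 + b n" for n
    using descent[of n] by (simp add: b_def)
  have nonneg: "0 \<le> \<gamma> n * (?g n)\<^sup>2 / 2" "0 \<le> b n" for n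
    using pos[of n] by (auto simp: b_def)
  note quasi = quasi_decreasing_convergent_summable[of "\<lambda>n. F (x n)",
      OF half nonneg \<open>summable b\<close> B[OF x_closure]]
  have summable: "summable (\<lambda>n. \<gamma> n * (?g n)\<^sup>2)"
    using summable_mult[OF quasi(2), of 2] by simp
  have "summable (\<lambda>n. \<gamma> n * (N (?G (x n)))\<^sup>2)"
  proof (rule summable_comparison_test'[OF summable_mult[OF summable, of "k\<^sup>2"]])
    fix n
    have "(N (?G (x n)))\<^sup>2 \<le> (k * ?g n)\<^sup>2"
      using k N_nonneg by (intro power_mono) auto
    then show "norm (\<gamma> n * (N (?G (x n)))\<^sup>2) \<le> k\<^sup>2 * (\<gamma> n * (?g n)\<^sup>2)"
      using pos[of n] by (simp add: power_mult_distrib mult_ac)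
  qed
  moreover have "limsup (\<lambda>n. ereal (N (?G (x n)))) = 0" if "\<not> summable \<gamma>"
  proof -
    have "uniformly_continuous_on (closure C) ?G"
      by (intro compact_uniformly_continuous C1_continuous_on_grad assms(3) compact)
    then have "(\<lambda>n. ?G (x n)) \<longlonglongrightarrow> 0"
      by (rule gradient_step_tendsto_zero[OF step _ x_closure pos summable that])
    then have "(\<lambda>n. k * ?g n) \<longlonglongrightarrow> 0"
      by (intro tendsto_mult_right_zero tendsto_norm_zero)
    then have "(\<lambda>n. N (?G (x n))) \<longlonglongrightarrow> 0"
      by (rule tendsto_sandwich[OF _ _ tendsto_const, rotated 2]) (auto simp: N_nonneg k)
    then have "(\<lambda>n. ereal (N (?G (x n)))) \<longlonglongrightarrow> ereal 0"
      by simp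
    from lim_imp_Limsup[OF _ this] show ?thesis
      by (simp add: zero_ereal_def)
  qed
  ultimately show ?thesis
    using quasi(1) by blast
qed

end
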